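(* For any $t\in\mathbb{C}$ and $f(\xi,z)\in\mathbb{C}[\xi,z]$, one has $$f(\xi,z)=\sum_{\alpha\in\mathbb{N}^n}\frac1{\alpha!}\,\xi^\alpha\ast_t a_\alpha(z)\qquad\text{(I)}$$ $$f(\xi,z)=\sum_{\alpha\in\mathbb{N}^n}\frac1{\alpha!}\,(\xi-t\partial_z)^\alpha a_\alpha(z)\qquad\text{(II)}$$ where, for any $\alpha\in\mathbb{N}^n$, $a_\alpha(z)=\mathcal{E}_t(\delta^\alpha f)\in\mathbb{C}[z]$. Furthermore, the expansions of $f(\xi,z)$ of the forms (I) and (II) (with coefficients $a_\alpha(z)\in\mathbb{C}[z]$, all but finitely many zero) are unique.
   Context: Let $\xi=(\xi_1,\dots,\xi_n)$ and $z=(z_1,\dots,z_n)$ be $2n$ commuting free variables, $\partial_i=\partial/\partial z_i$, $\delta_i=\partial/\partial\xi_i$, $\delta^\alpha=\delta_1^{\alpha_1}\cdots\delta_n^{\alpha_n}$, $\alpha!=\alpha_1!\cdots\alpha_n!$. For $t\in\mathbb{C}$, $\mathcal{B}_t[\xi,z]$ is the vector space $\mathbb{C}[\xi,z]$ with the product $f\ast_t g:=\mu\big(e^{-t\Omega}(f\otimes g)\big)$, where $\Omega=\sum_{i=1}^n(\partial_i\otimes\delta_i+\delta_i\otimes\partial_i)$ and $\mu(f\otimes g)=fg$ is the usual multiplication; it is a commutative algebra, freely generated by the $\xi_i$ and $z_i$, and $\ast_t$ restricted to $\mathbb{C}[z]$ is the usual product. $(\xi-t\partial_z)^\alpha=\prod_{i=1}^n(\xi_i-t\partial_i)^{\alpha_i}$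 is a differential operator (the factors commute, $\xi_i$ acting by usual multiplication), and $(\xi-t\partial_z)^\alpha a_\alpha(z)$ is the result of applying it to $a_\alpha(z)$. $\mathcal{E}_t:\mathcal{B}_t[\xi,z]\to\mathbb{C}[z]$ (the target with the usual product) is the unique algebra homomorphism with $\mathcal{E}_t(\xi_i)=0$ and $\mathcal{E}_t(z_i)=z_i$ for $1\le i\le n$. Explicitly, $\mathcal{E}_t$ is linear with $\mathcal{E}_t(\xi^\alpha p(z))=t^{|\alpha|}\partial^\alpha(p(z))$ for $\alpha\in\mathbb{N}^n$, $p(z)\in\mathbb{C}[z]$. *)

theory Defs
  imports Complex_Main "HOL-Library.Poly_Mapping"
begin

section \<open>Polynomials and linear maps\<close>

text \<open>
  The type \<open>'b \<Rightarrow>\<^sub>0 complex\<close> is the complex vector space with basis \<open>'b\<close>. With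
  \<open>'b = 'v \<Rightarrow>\<^sub>0 nat\<close> (the monomials in variables indexed by \<open>'v\<close>) the product of
  the library is the product of the polynomial ring in these variables.
\<close>

type_synonym 'v mpoly = "('v \<Rightarrow>\<^sub>0 nat) \<Rightarrow>\<^sub>0 complex"

definition smul :: "complex \<Rightarrow> ('b \<Rightarrow>\<^sub>0 complex) \<Rightarrow> ('b \<Rightarrow>\<^sub>0 complex)" where
  "smul c p = Poly_Mapping.map (\<lambda>x. c * x) p"

definition basis :: "'b \<Rightarrow> ('b \<Rightarrow>\<^sub>0 complex)" where
  "basis m = Poly_Mapping.single m 1"

definition linear_extension :: "('b \<Rightarrow> ('c \<Rightarrow>\<^sub>0 complex)) \<Rightarrow> ('b \<Rightarrow>\<^sub>0 complex) \<Rightarrow> ('c \<Rightarrow>\<^sub>0 complex)" where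
  "linear_extension h p = (\<Sum>m\<in>Poly_Mapping.keys p. smul (Poly_Mapping.lookup p m) (h m))"

definition Var :: "'v \<Rightarrow> 'v mpoly" where
  "Var v = basis (Poly_Mapping.single v 1)"

text \<open>
  In the definition of \<open>pderivative\<close> the subtraction of exponents is truncated, which is
  harmless because the coefficient vanishes if the variable \<open>v\<close> does not occur in \<open>m\<close>.
\<close>

definition pderivative :: "'v \<Rightarrow> 'v mpoly \<Rightarrow> 'v mpoly" where
  "pderivative v = linear_extension
     (\<lambda>m. smul (of_nat (Poly_Mapping.lookup m v)) (basis (m - Poly_Mapping.single v 1)))"


section \<open>Tensor products\<close>

text \<open>
  The tensor product of the spaces with bases \<open>'b\<close> and \<open>'c\<close> is the space with basis
  \<open>'b \<times> 'c\<close>; the basis vector \<open>(m, m')\<close> stands for the pure tensor of \<open>m\<close> and \<open>m'\<close>.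
\<close>

definition tensor :: "('b \<Rightarrow>\<^sub>0 complex) \<Rightarrow> ('c \<Rightarrow>\<^sub>0 complex) \<Rightarrow> (('b \<times> 'c) \<Rightarrow>\<^sub>0 complex)"
    (infixr \<open>\<otimes>\<close> 75) where
  "f \<otimes> g = linear_extension (\<lambda>m. linear_extension (\<lambda>m'. basis (m, m')) g) f"

definition tensor_map ::
  "(('b \<Rightarrow>\<^sub>0 complex) \<Rightarrow> ('b \<Rightarrow>\<^sub>0 complex)) \<Rightarrow> (('c \<Rightarrow>\<^sub>0 complex) \<Rightarrow> ('c \<Rightarrow>\<^sub>0 complex)) \<Rightarrow>
   (('b \<times> 'c) \<Rightarrow>\<^sub>0 complex) \<Rightarrow> (('b \<times> 'c) \<Rightarrow>\<^sub>0 complex)" where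
  "tensor_map D E = linear_extension (\<lambda>(m, m'). D (basis m) \<otimes> E (basis m'))"

type_synonym 'v mpoly_tensor = "(('v \<Rightarrow>\<^sub>0 nat) \<times> ('v \<Rightarrow>\<^sub>0 nat)) \<Rightarrow>\<^sub>0 complex"

definition mult_map :: "'v mpoly_tensor \<Rightarrow> 'v mpoly" where
  "mult_map = linear_extension (\<lambda>(m, m'). basis m * basis m')"


section \<open>The algebra \<open>B\<^sub>t[\<xi>, z]\<close>\<close>

text \<open>
  The variables are indexed by \<open>'n + 'n\<close>, where \<open>'n\<close> is a type with \<open>n\<close> elements:
  \<open>\<xi> i\<close> and \<open>Z i\<close> are the variables \<open>\<xi>\<^sub>i\<close> and \<open>z\<^sub>i\<close>.
\<close>

abbreviation \<xi> :: "'n \<Rightarrow> ('n + 'n) mpoly" where "\<xi> i \<equiv> Var (Inl i)"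
abbreviation Z :: "'n \<Rightarrow> ('n + 'n) mpoly" where "Z i \<equiv> Var (Inr i)"
abbreviation \<delta> :: "'n \<Rightarrow> ('n + 'n) mpoly \<Rightarrow> ('n + 'n) mpoly" where "\<delta> i \<equiv> pderivative (Inl i)"
abbreviation deriv_z :: "'n \<Rightarrow> ('n + 'n) mpoly \<Rightarrow> ('n + 'n) mpoly" (\<open>\<partial>\<close>) where "\<partial> i \<equiv> pderivative (Inr i)"

text \<open>
  \<open>polys_z\<close> is \<open>C[z]\<close> as a subspace of \<open>C[\<xi>, z]\<close>.
\<close>

definition polys_z :: "('n + 'n) mpoly set" where
  "polys_z = {p. \<forall>m\<in>Poly_Mapping.keys p. \<forall>i. Poly_Mapping.lookup m (Inl i) = 0}"

definition \<Omega> :: "('n::finite + 'n) mpoly_tensor \<Rightarrow> ('n + 'n) mpoly_tensor" where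
  "\<Omega> u = (\<Sum>i\<in>UNIV. tensor_map (\<partial> i) (\<delta> i) u + tensor_map (\<delta> i) (\<partial> i) u)"

text \<open>
  \<open>Sum_any\<close> sums the finitely many nonzero values of a function. In \<open>exp_op\<close> there are only
  finitely many for every \<open>u\<close> if \<open>D\<close> is locally nilpotent, as \<open>\<Omega>\<close> is.
\<close>

definition exp_op :: "complex \<Rightarrow> (('b \<Rightarrow>\<^sub>0 complex) \<Rightarrow> ('b \<Rightarrow>\<^sub>0 complex)) \<Rightarrow> ('b \<Rightarrow>\<^sub>0 complex) \<Rightarrow> ('b \<Rightarrow>\<^sub>0 complex)" where
  "exp_op c D u = Sum_any (\<lambda>k::nat. smul (c ^ k / fact k) ((D ^^ k) u))"

definition star :: "complex \<Rightarrow> ('n::finite + 'n) mpoly \<Rightarrow> ('n + 'n) mpoly \<Rightarrow> ('n + 'n) mpoly" where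
  "star t f g = mult_map (exp_op (- t) \<Omega> (f \<otimes> g))"

text \<open>
  \<open>\<E> t\<close> is the unique homomorphism from \<open>B\<^sub>t[\<xi>, z]\<close> to \<open>C[z]\<close> (with the usual product)
  that maps \<open>\<xi>\<^sub>i\<close> to \<open>0\<close> and \<open>z\<^sub>i\<close> to \<open>z\<^sub>i\<close>.
\<close>

definition is_evaluation :: "complex \<Rightarrow> (('n::finite + 'n) mpoly \<Rightarrow> ('n + 'n) mpoly) \<Rightarrow> bool" where
  "is_evaluation t \<phi> \<longleftrightarrow>
     (\<forall>f. \<phi> f \<in> polys_z) \<and>
     (\<forall>f g. \<phi> (f + g) = \<phi> f + \<phi> g) \<and>
     (\<forall>c f. \<phi> (smul c f) = smul c (\<phi> f)) \<and>
     \<phi> 1 = 1 \<and>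
     (\<forall>f g. \<phi> (star t f g) = \<phi> f * \<phi> g) \<and>
     (\<forall>i. \<phi> (\<xi> i) = 0 \<and> \<phi> (Z i) = Z i)"

definition \<E> :: "complex \<Rightarrow> ('n::finite + 'n) mpoly \<Rightarrow> ('n + 'n) mpoly" where
  "\<E> t = (THE \<phi>. is_evaluation t \<phi>)"


section \<open>Multi-indices\<close>

text \<open>
  \<open>op_power D \<alpha>\<close> is the product of the powers \<open>D i ^^ \<alpha> i\<close>. It is meant for pairwise
  commuting \<open>D i\<close>, for which the order of the factors does not matter.
\<close>

definition op_power :: "('n::finite \<Rightarrow> 'a \<Rightarrow> 'a) \<Rightarrow> ('n \<Rightarrow> nat) \<Rightarrow> 'a \<Rightarrow> 'a" where
  "op_power D \<alpha> f = Finite_Set.fold (\<lambda>i. D i ^^ \<alpha> i) f UNIV"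

definition \<xi>_power :: "('n::finite \<Rightarrow> nat) \<Rightarrow> ('n + 'n) mpoly" where
  "\<xi>_power \<alpha> = (\<Prod>i\<in>UNIV. \<xi> i ^ \<alpha> i)"

definition mfact :: "('n::finite \<Rightarrow> nat) \<Rightarrow> complex" where
  "mfact \<alpha> = (\<Prod>i\<in>UNIV. fact (\<alpha> i))"

definition shift_op :: "complex \<Rightarrow> 'n \<Rightarrow> ('n + 'n) mpoly \<Rightarrow> ('n + 'n) mpoly" where
  "shift_op t i g = \<xi> i * g - smul t (\<partial> i g)"

definition coefficient_family :: "(('n \<Rightarrow> nat) \<Rightarrow> ('n + 'n) mpoly) \<Rightarrow> bool" where
  "coefficient_family a \<longleftrightarrow> (\<forall>\<alpha>. a \<alpha> \<in> polys_z) \<and> finite {\<alpha>. a \<alpha> \<noteq> 0}"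

definition expansion_I ::
  "complex \<Rightarrow> (('n::finite \<Rightarrow> nat) \<Rightarrow> ('n + 'n) mpoly) \<Rightarrow> ('n + 'n) mpoly" where
  "expansion_I t a = Sum_any (\<lambda>\<alpha>. smul (1 / mfact \<alpha>) (star t (\<xi>_power \<alpha>) (a \<alpha>)))"

definition expansion_II ::
  "complex \<Rightarrow> (('n::finite \<Rightarrow> nat) \<Rightarrow> ('n + 'n) mpoly) \<Rightarrow> ('n + 'n) mpoly" where
  "expansion_II t a = Sum_any (\<lambda>\<alpha>. smul (1 / mfact \<alpha>) (op_power (shift_op t) \<alpha> (a \<alpha>)))"

end

theory Submission
  imports Defs
begin

text \<open>
  The idea is that the star product is the usual product in disguise. Let
  \<open>\<Lambda> = \<Sum>\<^sub>i \<delta>\<^sub>i \<partial>\<^sub>i\<close> be the mixed Laplacian and \<open>\<Phi> = exp (t \<Lambda>)\<close>, called \<open>exp_laplacian t\<close> below.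
  Then \<open>\<Phi>\<close> is bijective with inverse \<open>exp (- t \<Lambda>)\<close>, and \<open>\<Phi> (f \<star> g) = \<Phi> f \<cdot> \<Phi> g\<close>
  (\<open>exp_laplacian_star\<close>), so that \<open>\<Phi>\<close> is an isomorphism from \<open>B\<^sub>t[\<xi>, z]\<close> to the polynomial ring
  with its usual product. It commutes with all partial derivatives and fixes every polynomial
  in \<open>\<xi>\<close> alone and every polynomial in \<open>z\<close> alone.

  Three facts follow. The homomorphism \<open>\<E> t\<close> exists, is unique, and is \<open>\<Phi>\<close> followed by the
  substitution \<open>\<xi> = 0\<close> (\<open>evaluation_eq\<close>), because homomorphisms of the usual polynomial ring are
  determined by their values on the variables. Since \<open>\<Phi>\<close> commutes with \<open>\<delta>\<^sup>\<alpha>\<close>, the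
  coefficient \<open>a\<^sub>\<alpha> = \<E> t (\<delta>\<^sup>\<alpha> f)\<close> is the value of \<open>\<delta>\<^sup>\<alpha> (\<Phi> f)\<close> at \<open>\<xi> = 0\<close>, that is, a Taylor coefficient of
  \<open>\<Phi> f\<close>. Finally, for a polynomial \<open>b\<close> in \<open>z\<close>, both \<open>\<xi>\<^sup>\<alpha> \<star> b\<close> and \<open>(\<xi> - t \<partial>)\<^sup>\<alpha> b\<close> are mapped by
  \<open>\<Phi>\<close> to the ordinary product \<open>\<xi>\<^sup>\<alpha> b\<close>. Therefore both expansions of \<open>f\<close> are the preimage of the
  Taylor expansion of \<open>\<Phi> f\<close> in \<open>\<xi>\<close> (\<open>taylor_expansion_iff\<close>), and existence and uniqueness
  are those of Taylor coefficients.

  Properties of \<open>\<Phi>\<close> and of the star product are proved by induction on polynomials, built from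
  \<open>1\<close> by linear combinations and multiplication by variables. The induction step is
  always the same commutation rule \<open>exp (c D) X = (X + c Y) exp (c D)\<close>, valid if \<open>Y = [D, X]\<close>
  commutes with \<open>D\<close> (\<open>exp_op_commutator\<close>). It applies to multiplication by a variable
  together with \<open>D = \<Lambda>\<close> or \<open>D = \<Omega>\<close>.
\<close>

section \<open>Linear maps on spaces with a basis\<close>

lemma lookup_smul [simp]: "Poly_Mapping.lookup (smul c p) m = c * Poly_Mapping.lookup p m"
  by (simp add: smul_def map.rep_eq when_def)

lemma lookup_basis: "Poly_Mapping.lookup (basis m) k = (if m = k then 1 else 0)"
  by (simp add: basis_def lookup_single when_def)

interpretation smul: module "smul :: complex \<Rightarrow> ('b \<Rightarrow>\<^sub>0 complex) \<Rightarrow> _"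
  by unfold_locales (auto intro!: poly_mapping_eqI simp: lookup_add algebra_simps)

abbreviation linear_map :: "(('b \<Rightarrow>\<^sub>0 complex) \<Rightarrow> ('c \<Rightarrow>\<^sub>0 complex)) \<Rightarrow> bool" where
  "linear_map \<equiv> module_hom smul smul"

lemma linear_mapI:
  assumes "\<And>x y. D (x + y) = D x + D y" "\<And>c x. D (smul c x) = smul c (D x)"
  shows "linear_map D"
  using assms by unfold_locales auto

lemmas linear_map_compose = module_hom_compose[where ?s1.0=smul and ?s2.0=smul and ?s3.0=smul, unfolded o_def]

lemma linear_map_sum:
  assumes "\<And>i. i \<in> I \<Longrightarrow> linear_map (D i)"
  shows "linear_map (\<lambda>x. \<Sum>i\<in>I. D i x)"
proof -
  interpret module_pair smul smul ..
  show ?thesis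
    using assms by (intro module_hom_sum) (auto intro: smul.module_axioms)
qed

lemma basis_expansion:
  assumes "finite S" "Poly_Mapping.keys p \<subseteq> S"
  shows "p = (\<Sum>m\<in>S. smul (Poly_Mapping.lookup p m) (basis m))"
proof (rule poly_mapping_eqI)
  fix k
  have "Poly_Mapping.lookup (\<Sum>m\<in>S. smul (Poly_Mapping.lookup p m) (basis m)) k
      = (\<Sum>m\<in>S. if m = k then Poly_Mapping.lookup p m else 0)"
    by (auto simp: lookup_sum lookup_basis intro!: sum.cong)
  also have "\<dots> = Poly_Mapping.lookup p k"
    using assms by (auto simp: sum.delta in_keys_iff)
  finally show "Poly_Mapping.lookup p k = 
      Poly_Mapping.lookup (\<Sum>m\<in>S. smul (Poly_Mapping.lookup p m) (basis m)) k" by simp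
qed

text \<open>
  The zero vector needs no case of its own because it is \<open>smul 0 (basis m)\<close>.
\<close>
lemma basis_induct [case_names basis add smul]:
  fixes p :: "'b \<Rightarrow>\<^sub>0 complex"
  assumes basis: "\<And>m. P (basis m)"
    and add: "\<And>p q. P p \<Longrightarrow> P q \<Longrightarrow> P (p + q)"
    and smul: "\<And>c p. P p \<Longrightarrow> P (smul c p)"
  shows "P p"
proof -
  have zero: "P 0"
    using smul[OF basis, of 0] by simp
  have "P (\<Sum>m\<in>S. smul (c m) (basis m))" if "finite S" for S and c :: "'b \<Rightarrow> complex"
    using that by induction (auto intro: zero assms)
  then show ?thesis
    using basis_expansion[of "Poly_Mapping.keys p" p] by (metis finite_keys order_refl)
qed

lemma linear_map_eqI:
  assumes "linear_map S" "linear_map T" "\<And>m. S (basis m) = T (basis m)"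
  shows "S p = T p"
proof -
  interpret S: module_hom smul smul S by fact
  interpret T: module_hom smul smul T by fact
  show ?thesis
    by (induction p rule: basis_induct) (simp_all add: assms S.add T.add S.scale T.scale)
qed

lemma linear_extension_superset:
  assumes "finite S" "Poly_Mapping.keys p \<subseteq> S"
  shows "linear_extension h p = (\<Sum>m\<in>S. smul (Poly_Mapping.lookup p m) (h m))"
  unfolding linear_extension_def
  using assms by (intro sum.mono_neutral_left) (auto simp: in_keys_iff)

lemma linear_map_linear_extension: "linear_map (linear_extension h)"
proof (rule linear_mapI)
  fix p q :: "'a \<Rightarrow>\<^sub>0 complex"
  let ?S = "Poly_Mapping.keys p \<union> Poly_Mapping.keys q"
  have fin: "finite ?S" by simp
  show "linear_extension h (p + q) = linear_extension h p + linear_extension h q"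
    using Poly_Mapping.keys_add[of p q]
    by (simp add: linear_extension_superset[OF fin] lookup_add smul.scale_left_distrib sum.distrib)
next
  fix c and p :: "'a \<Rightarrow>\<^sub>0 complex"
  have "Poly_Mapping.keys (smul c p) \<subseteq> Poly_Mapping.keys p"
    by (auto simp: in_keys_iff)
  then show "linear_extension h (smul c p) = smul c (linear_extension h p)"
    by (simp add: linear_extension_superset[of "Poly_Mapping.keys p"] smul.scale_sum_right)
qed

lemma linear_extension_basis [simp]: "linear_extension h (basis m) = h m"
  by (subst linear_extension_superset[of "{m}"]) (auto simp: in_keys_iff lookup_basis split: if_splits)

lemma linear_map_Sum_any:
  assumes "linear_map T" "finite {x. g x \<noteq> 0}"
  shows "T (Sum_any g) = Sum_any (\<lambda>x. T (g x))"
proof -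
  interpret T: module_hom smul smul T by fact
  have "{x. T (g x) \<noteq> 0} \<subseteq> {x. g x \<noteq> 0}" by auto
  then show ?thesis
    using assms(2)
    by (simp add: Sum_any.expand_superset[of "{x. g x \<noteq> 0}"] T.sum)
qed

section \<open>The exponential of a locally nilpotent operator\<close>

text \<open>
  The sum defining \<open>exp_op c D u\<close> is meaningful at a vector \<open>u\<close> that some power of \<open>D\<close>
  kills. Nilpotency is asked for one vector at a time, so that it can be proved by the
  same inductions that compute the exponential.
\<close>
definition nilpotent_at :: "('a \<Rightarrow> 'a::zero) \<Rightarrow> 'a \<Rightarrow> bool" where
  "nilpotent_at D u \<longleftrightarrow> (\<exists>N. (D ^^ N) u = 0)"

lemma linear_map_funpow:
  fixes D :: "('b \<Rightarrow>\<^sub>0 complex) \<Rightarrow> ('b \<Rightarrow>\<^sub>0 complex)"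
  assumes "linear_map D" shows "linear_map (D ^^ k)"
proof (induction k)
  case 0 then show ?case by (intro linear_mapI) auto
next
  case (Suc k) then show ?case
    using assms by (auto intro: linear_map_compose[of "D ^^ k" D] simp: o_def)
qed

lemma funpow_zero_mono:
  fixes D :: "('b \<Rightarrow>\<^sub>0 complex) \<Rightarrow> ('b \<Rightarrow>\<^sub>0 complex)"
  assumes "linear_map D" "(D ^^ N) u = 0" "N \<le> k"
  shows "(D ^^ k) u = 0"
proof -
  interpret E: module_hom smul smul "D ^^ (k - N)" by (rule linear_map_funpow) fact
  have "(D ^^ k) u = (D ^^ (k - N)) ((D ^^ N) u)"
    using assms(3) by (metis comp_apply funpow_add le_add_diff_inverse2)
  then show ?thesis using assms(2) by simp
qed

lemma exp_op_eq_sum: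
  assumes "linear_map D" "(D ^^ N) u = 0"
  shows "exp_op c D u = (\<Sum>k<N. smul (c ^ k / fact k) ((D ^^ k) u))"
  unfolding exp_op_def
proof (rule Sum_any.expand_superset)
  show "{k. smul (c ^ k / fact k) ((D ^^ k) u) \<noteq> 0} \<subseteq> {..<N}"
    using funpow_zero_mono[OF assms] by (force simp: not_less[symmetric])
qed simp

lemma nilpotent_at_common_exponent:
  assumes "linear_map D" "nilpotent_at D u" "nilpotent_at D v"
  obtains N where "(D ^^ N) u = 0" "(D ^^ N) v = 0"
proof -
  obtain M M' where "(D ^^ M) u = 0" "(D ^^ M') v = 0"
    using assms by (auto simp: nilpotent_at_def)
  then show thesis
    using that[of "max M M'"] funpow_zero_mono[OF assms(1)] by (meson max.cobounded1 max.cobounded2)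
qed

lemma exp_op_add:
  assumes "linear_map D" "nilpotent_at D u" "nilpotent_at D v"
  shows "nilpotent_at D (u + v)" "exp_op c D (u + v) = exp_op c D u + exp_op c D v"
proof -
  obtain N where N: "(D ^^ N) u = 0" "(D ^^ N) v = 0"
    using assms by (rule nilpotent_at_common_exponent)
  have add: "(D ^^ k) (u + v) = (D ^^ k) u + (D ^^ k) v" for k
    by (rule module_hom.add[OF linear_map_funpow[OF assms(1)]])
  then have sum: "(D ^^ N) (u + v) = 0" using N by simp
  then show "nilpotent_at D (u + v)" by (auto simp: nilpotent_at_def)
  show "exp_op c D (u + v) = exp_op c D u + exp_op c D v"
    using sum N by (simp add: exp_op_eq_sum[OF assms(1), of N] add smul.scale_right_distrib sum.distrib)
qed

lemma exp_op_smul: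
  assumes "linear_map D" "nilpotent_at D u"
  shows "nilpotent_at D (smul b u)" "exp_op c D (smul b u) = smul b (exp_op c D u)"
proof -
  obtain N where N: "(D ^^ N) u = 0"
    using assms(2) by (auto simp: nilpotent_at_def)
  have scale: "(D ^^ k) (smul b u) = smul b ((D ^^ k) u)" for k
    by (rule module_hom.scale[OF linear_map_funpow[OF assms(1)]])
  then have b: "(D ^^ N) (smul b u) = 0" using N by simp
  then show "nilpotent_at D (smul b u)" by (auto simp: nilpotent_at_def)
  show "exp_op c D (smul b u) = smul b (exp_op c D u)"
    using b N by (simp add: exp_op_eq_sum[OF assms(1), of N] scale smul.scale_sum_right mult.commute)
qed

lemma exp_op_kernel:
  assumes "linear_map D" "D u = 0"
  shows "nilpotent_at D u" "exp_op c D u = u"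
proof -
  have "(D ^^ 1) u = 0" using assms by simp
  then show "nilpotent_at D u" "exp_op c D u = u"
    using exp_op_eq_sum[OF assms(1), of 1 u c] by (auto simp: nilpotent_at_def simp del: funpow.simps(2))
qed

text \<open>
  Apart from linearity, the one fact about exponentials that is needed. If the commutator \<open>Y = [D, X]\<close>
  itself commutes with \<open>D\<close>, then \<open>D\<^sup>k X = X D\<^sup>k + k Y D\<^sup>k\<^sup>-\<^sup>1\<close>, and summation over \<open>k\<close> gives
  \<open>exp (c D) X = (X + c Y) exp (c D)\<close>. In the main applications \<open>X\<close> multiplies by a variable; as
  polynomials are generated from \<open>1\<close> by such operators, the first conclusion proves local
  nilpotency and the second one determines the exponential.
\<close>
lemma exp_op_commutator:
  fixes D :: "('b \<Rightarrow>\<^sub>0 complex) \<Rightarrow> ('b \<Rightarrow>\<^sub>0 complex)"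
  assumes lin: "linear_map D" "linear_map X" "linear_map Y"
    and DX: "\<And>u. D (X u) = X (D u) + Y u"
    and DY: "\<And>u. D (Y u) = Y (D u)"
    and nil: "nilpotent_at D u"
  shows "nilpotent_at D (X u)"
    "exp_op c D (X u) = X (exp_op c D u) + smul c (Y (exp_op c D u))"
proof -
  interpret D: module_hom smul smul D by fact
  interpret X: module_hom smul smul X by fact
  interpret Y: module_hom smul smul Y by fact
  have Suc_smul: "smul (of_nat (Suc k)) w = w + smul (of_nat k) w" for k and w :: "'b \<Rightarrow>\<^sub>0 complex"
    by (simp add: smul.scale_left_distrib)
  have pow: "(D ^^ Suc k) (X u) = X ((D ^^ Suc k) u) + smul (of_nat (Suc k)) (Y ((D ^^ k) u))" for k
    by (induction k) (simp_all add: DX DY D.add D.scale Suc_smul add.assoc del: of_nat_Suc)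
  obtain N where N: "(D ^^ N) u = 0"
    using nil by (auto simp: nilpotent_at_def)
  then have X0: "(D ^^ Suc N) (X u) = 0"
    using pow[of N] by (simp del: funpow.simps add: funpow_zero_mono[OF lin(1) N])
  then show "nilpotent_at D (X u)" by (auto simp only: nilpotent_at_def)
  (* The factor k of the second summand turns 1/k! into 1/(k-1)!. *)
  have coeff: "c ^ Suc k / fact (Suc k) * of_nat (Suc k) = c * (c ^ k / fact k)" for k :: nat
  proof -
    have "(fact (Suc k) :: complex) = of_nat (Suc k) * fact k" by simp
    moreover have "(of_nat (Suc k) :: complex) \<noteq> 0" by (rule of_nat_neq_0)
    ultimately show ?thesis by (simp del: of_nat_Suc fact_Suc)
  qed
  have "exp_op c D (X u) = (\<Sum>k<Suc N. smul (c ^ k / fact k) ((D ^^ k) (X u)))"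
    by (rule exp_op_eq_sum[OF lin(1) X0])
  also have "\<dots> = X u + (\<Sum>k<N. smul (c ^ Suc k / fact (Suc k)) ((D ^^ Suc k) (X u)))"
    by (subst sum.lessThan_Suc_shift) simp
  also have "\<dots> = X u + (\<Sum>k<N. smul (c ^ Suc k / fact (Suc k)) (X ((D ^^ Suc k) u)))
      + (\<Sum>k<N. smul (c * (c ^ k / fact k)) (Y ((D ^^ k) u)))"
    unfolding pow smul.scale_right_distrib smul.scale_scale coeff sum.distrib by (simp only: add.assoc)
  also have "X u + (\<Sum>k<N. smul (c ^ Suc k / fact (Suc k)) (X ((D ^^ Suc k) u)))
      = (\<Sum>k<Suc N. smul (c ^ k / fact k) (X ((D ^^ k) u)))"
    by (subst sum.lessThan_Suc_shift) simp
  also have "\<dots> = X (exp_op c D u)"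
    by (simp add: exp_op_eq_sum[OF lin(1) N] X.sum X.scale N)
  also have "(\<Sum>k<N. smul (c * (c ^ k / fact k)) (Y ((D ^^ k) u))) = smul c (Y (exp_op c D u))"
    by (simp add: exp_op_eq_sum[OF lin(1) N] Y.sum Y.scale smul.scale_sum_right)
  finally show "exp_op c D (X u) = X (exp_op c D u) + smul c (Y (exp_op c D u))" .
qed

lemma exp_op_commute:
  assumes lin: "linear_map D" "linear_map X"
    and DX: "\<And>u. D (X u) = X (D u)"
    and nil: "nilpotent_at D u"
  shows "exp_op c D (X u) = X (exp_op c D u)"
proof -
  interpret D: module_hom smul smul D by fact
  have "linear_map (\<lambda>_. 0 :: 'a \<Rightarrow>\<^sub>0 complex)" by (intro linear_mapI) auto
  from exp_op_commutator(2)[OF lin this _ _ nil] show ?thesis by (simp add: DX)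
qed

section \<open>Polynomials and partial derivatives\<close>

lemma smul_eq_mult: "smul c f = Poly_Mapping.single 0 c * (f :: 'v mpoly)"
proof -
  have *: "smul c f = Poly_Mapping.single 0 c * f" if "f = Poly_Mapping.single m d" for m d and f :: "'v mpoly"
    unfolding that by (intro poly_mapping_eqI) (simp add: mult_single lookup_single when_def)
  have "smul d (basis m) = Poly_Mapping.single m d" for d and m :: "'v \<Rightarrow>\<^sub>0 nat"
    by (intro poly_mapping_eqI) (simp add: basis_def lookup_single when_def)
  with * have "smul c (smul d (basis m)) = Poly_Mapping.single 0 c * smul d (basis m)" for d and m :: "'v \<Rightarrow>\<^sub>0 nat"
    by blast
  then have "smul c (\<Sum>m\<in>S. smul (d m) (basis m)) = Poly_Mapping.single 0 c * (\<Sum>m\<in>S. smul (d m) (basis m))"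
    for S and d :: "('v \<Rightarrow>\<^sub>0 nat) \<Rightarrow> complex"
    by (simp only: smul.scale_sum_right sum_distrib_left)
  from this[of "Poly_Mapping.lookup f" "Poly_Mapping.keys f"] show ?thesis
    by (simp only: basis_expansion[OF finite_keys order_refl, symmetric])
qed

lemma smul_mult_left [simp]: "smul c f * g = smul c (f * g)" for f g :: "'v mpoly"
  by (simp add: smul_eq_mult mult.assoc)

lemma smul_mult_right [simp]: "f * smul c g = smul c (f * g)" for f g :: "'v mpoly"
  by (simp add: smul_eq_mult mult.left_commute)

lemma linear_map_mult: "linear_map (\<lambda>f. g * f)" for g :: "'v mpoly"
  by (intro linear_mapI) (simp_all add: algebra_simps)

lemma basis_mult: "basis m * basis k = basis (m + k)" for m k :: "'v \<Rightarrow>\<^sub>0 nat"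
  by (simp add: basis_def mult_single)

lemma basis_zero: "basis (0 :: 'v \<Rightarrow>\<^sub>0 nat) = 1"
  by (simp add: basis_def)

lemma lookup_basis_mult:
  "Poly_Mapping.lookup (basis k * f) m
    = (if \<exists>m'. m = k + m' then Poly_Mapping.lookup f (m - k) else 0)" for f :: "'v mpoly"
proof (induction f rule: basis_induct)
  case (basis l)
  have "k + l = m \<longleftrightarrow> (\<exists>m'. m = k + m') \<and> l = m - k" by auto
  then show ?case by (simp add: basis_mult lookup_basis)
qed (auto simp: lookup_add algebra_simps)

lemma basis_single: "basis (Poly_Mapping.single v k) = Var v ^ k"
proof (induction k)
  case (Suc k)
  have "Poly_Mapping.single v (Suc k) = Poly_Mapping.single v 1 + Poly_Mapping.single v k"
    by (simp flip: single_add)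
  then show ?case using Suc by (simp add: Var_def flip: basis_mult)
qed (simp add: basis_zero)

text \<open>
  Adding one variable at a time, instead of a power of a variable, matches the commutation
  relations, which are about multiplication by a single variable.
\<close>
lemma monomial_induct [case_names zero Suc]:
  fixes m :: "'v \<Rightarrow>\<^sub>0 nat"
  assumes "P 0" "\<And>v m. P m \<Longrightarrow> P (Poly_Mapping.single v 1 + m)"
  shows "P m"
proof -
  have *: "P (Poly_Mapping.single v k + m)" if "P m" for v k m
    using that by (induction k) (auto simp: single_add add.assoc dest: assms(2) simp flip: One_nat_def plus_1_eq_Suc)
  have "finite (Poly_Mapping.keys m)" by simp
  then show ?thesis
  proof (induction "Poly_Mapping.keys m" arbitrary: m rule: finite_induct)
    case empty
    then have "m = 0" by (intro poly_mapping_eqI) (auto simp: in_keys_iff)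
    then show ?case using assms(1) by simp
  next
    case (insert v S)
    define m' where "m' = m - Poly_Mapping.single v (Poly_Mapping.lookup m v)"
    have m: "m = Poly_Mapping.single v (Poly_Mapping.lookup m v) + m'"
      by (intro poly_mapping_eqI) (auto simp: m'_def lookup_add lookup_minus lookup_single when_def)
    have "Poly_Mapping.lookup m' w = (if w = v then 0 else Poly_Mapping.lookup m w)" for w
      by (auto simp: m'_def lookup_minus lookup_single when_def)
    then have "Poly_Mapping.keys m' = Poly_Mapping.keys m - {v}"
      by (auto simp: in_keys_iff split: if_splits)
    then have "S = Poly_Mapping.keys m'" using insert by auto
    then show ?case using insert.hyps(3)[of m'] * m by metis
  qed
qed

lemma mpoly_induct [case_names one add smul Var]:
  fixes f :: "'v mpoly"
  assumes one: "P 1"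
    and add: "\<And>f g. P f \<Longrightarrow> P g \<Longrightarrow> P (f + g)"
    and smul: "\<And>c f. P f \<Longrightarrow> P (smul c f)"
    and Var: "\<And>v f. P f \<Longrightarrow> P (Var v * f)"
  shows "P f"
proof (induction f rule: basis_induct)
  case (basis m)
  show ?case
    by (induction m rule: monomial_induct)
      (use one Var in \<open>auto simp: basis_zero basis_single simp flip: basis_mult\<close>)
qed (fact add smul)+

lemma linear_map_pderivative: "linear_map (pderivative v)"
  unfolding pderivative_def by (rule linear_map_linear_extension)

interpretation pderivative: module_hom smul smul "pderivative v :: 'v mpoly \<Rightarrow> 'v mpoly" for v
  by (rule linear_map_pderivative)

text \<open>
  Read on coefficients, partial differentiation is a shift with a weight. This makes
  identities between derivatives a matter of arithmetic on exponents.
\<close>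
lemma lookup_pderivative:
  "Poly_Mapping.lookup (pderivative v f) m =
    of_nat (Suc (Poly_Mapping.lookup m v)) * Poly_Mapping.lookup f (m + Poly_Mapping.single v 1)"
proof (induction f rule: basis_induct)
  case (basis k)
  show ?case
  proof (cases "Poly_Mapping.lookup k v = 0")
    case True
    then have "k \<noteq> m + Poly_Mapping.single v 1"
      by (auto simp: lookup_add)
    then show ?thesis using True by (simp add: pderivative_def lookup_basis)
  next
    case False
    have "k = (k - Poly_Mapping.single v 1) + Poly_Mapping.single v 1"
      using False by (intro poly_mapping_eqI) (auto simp: lookup_add lookup_minus lookup_single when_def)
    then have "k - Poly_Mapping.single v 1 = m \<longleftrightarrow> k = m + Poly_Mapping.single v 1"
      by (metis add_diff_cancel_right')
    then show ?thesis by (auto simp: pderivative_def lookup_basis lookup_add)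
  qed
qed (simp_all add: pderivative.add pderivative.scale lookup_add algebra_simps)

lemma pderivative_commute: "pderivative v (pderivative w f) = pderivative w (pderivative v f)"
  by (intro poly_mapping_eqI)
    (auto simp: lookup_pderivative lookup_add lookup_single when_def ac_simps)

lemma pderivative_one [simp]: "pderivative v 1 = 0"
  by (simp add: pderivative_def flip: basis_zero)

lemma lookup_Var_mult:
  "Poly_Mapping.lookup (Var w * f) m = (if Poly_Mapping.lookup m w = 0 then 0
     else Poly_Mapping.lookup f (m - Poly_Mapping.single w 1))"
proof -
  have "(\<exists>m'. m = Poly_Mapping.single w 1 + m') \<longleftrightarrow> Poly_Mapping.lookup m w \<noteq> 0"
  proof
    assume "Poly_Mapping.lookup m w \<noteq> 0"
    then have "m = Poly_Mapping.single w 1 + (m - Poly_Mapping.single w 1)"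
      by (intro poly_mapping_eqI) (auto simp: lookup_add lookup_minus lookup_single when_def)
    then show "\<exists>m'. m = Poly_Mapping.single w 1 + m'" by blast
  qed (auto simp: lookup_add)
  then show ?thesis by (simp add: Var_def lookup_basis_mult)
qed

lemma pderivative_Var_mult:
  "pderivative v (Var w * f) = (if v = w then f else 0) + Var w * pderivative v f"
proof (rule poly_mapping_eqI)
  fix m :: "'a \<Rightarrow>\<^sub>0 nat"
  show "Poly_Mapping.lookup (pderivative v (Var w * f)) m =
    Poly_Mapping.lookup ((if v = w then f else 0) + Var w * pderivative v f) m"
  proof (cases "Poly_Mapping.lookup m w = 0")
    case True
    then show ?thesis
      by (simp add: lookup_pderivative lookup_Var_mult lookup_add lookup_single when_def)
  next
    case False
    then have "m + Poly_Mapping.single v 1 - Poly_Mapping.single w 1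
        = m - Poly_Mapping.single w 1 + Poly_Mapping.single v 1"
      by (intro poly_mapping_eqI) (auto simp: lookup_add lookup_minus lookup_single when_def)
    moreover have "v = w \<Longrightarrow> m - Poly_Mapping.single w 1 + Poly_Mapping.single v 1 = m"
      using False by (intro poly_mapping_eqI) (auto simp: lookup_add lookup_minus lookup_single when_def)
    ultimately show ?thesis
      using False
      by (auto simp: lookup_pderivative lookup_Var_mult lookup_add lookup_minus lookup_single when_def
          of_nat_diff ring_distribs)
  qed
qed

lemma pderivative_mult: "pderivative v (f * g) = pderivative v f * g + f * pderivative v g"
proof (induction f rule: mpoly_induct)
  case (Var w f)
  then show ?case by (simp add: pderivative_Var_mult mult.assoc) (simp add: algebra_simps)
qed (simp_all add: pderivative.add pderivative.scale algebra_simps smul.scale_right_distrib)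

section \<open>Tensor products and linear maps\<close>

lemma lookup_linear_extension:
  "Poly_Mapping.lookup (linear_extension h p) k
    = (\<Sum>m\<in>Poly_Mapping.keys p. Poly_Mapping.lookup p m * Poly_Mapping.lookup (h m) k)"
  by (simp add: linear_extension_def lookup_sum)

lemma lookup_tensor [simp]:
  "Poly_Mapping.lookup (f \<otimes> g) (m, m') = Poly_Mapping.lookup f m * Poly_Mapping.lookup g m'"
proof -
  have inner: "Poly_Mapping.lookup (linear_extension (\<lambda>m'. basis (k, m')) g) (m, m')
      = (if k = m then Poly_Mapping.lookup g m' else 0)" for k
  proof (induction g rule: basis_induct)
    case (add p q)
    then show ?case by (simp add: module_hom.add[OF linear_map_linear_extension] lookup_add)
  next
    case (smul c p)
    then show ?case by (simp add: module_hom.scale[OF linear_map_linear_extension])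
  qed (auto simp: lookup_basis)
  show ?thesis
    unfolding tensor_def
    by (subst lookup_linear_extension)
      (simp add: inner if_distrib[of "\<lambda>x. _ * x"] sum.delta in_keys_iff cong: if_cong)
qed

lemma linear_map_tensor_left: "linear_map (\<lambda>f. f \<otimes> g)"
  and linear_map_tensor_right: "linear_map (\<lambda>g. f \<otimes> g)"
  by (auto intro!: linear_mapI poly_mapping_eqI simp: lookup_add algebra_simps)

interpretation tensor_left: module_hom smul smul "\<lambda>f. f \<otimes> g" for g
  by (rule linear_map_tensor_left)

interpretation tensor_right: module_hom smul smul "\<lambda>g. f \<otimes> g" for f
  by (rule linear_map_tensor_right)

text \<open>
  Every tensor is a combination of pure ones, so that linear maps on tensors may be compared
  on pure tensors of arbitrary polynomials, where the action of \<open>\<Omega>\<close> is explicit.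
\<close>
lemma basis_Pair: "basis (m, m') = basis m \<otimes> basis m'"
proof (rule poly_mapping_eqI)
  fix k :: "'a \<times> 'b"
  show "Poly_Mapping.lookup (basis (m, m')) k = Poly_Mapping.lookup (basis m \<otimes> basis m') k"
    by (cases k) (simp add: lookup_basis)
qed

lemma tensor_eqI:
  assumes "linear_map S" "linear_map T" "\<And>f g. S (f \<otimes> g) = T (f \<otimes> g)"
  shows "S u = T u"
  by (rule linear_map_eqI[OF assms(1,2)]) (auto simp: basis_Pair assms(3))

lemma bilinear_eqI:
  assumes "\<And>g. linear_map (\<lambda>f. S f g)" "\<And>g. linear_map (\<lambda>f. T f g)"
    and "\<And>f. linear_map (\<lambda>g. S f g)" "\<And>f. linear_map (\<lambda>g. T f g)"
    and "\<And>m m'. S (basis m) (basis m') = T (basis m) (basis m')"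
  shows "S f g = T f g"
proof -
  have "S (basis m) g = T (basis m) g" for m
    by (rule linear_map_eqI[OF assms(3,4)]) (rule assms(5))
  from linear_map_eqI[OF assms(1,2) this] show ?thesis .
qed

lemma linear_map_tensor_map: "linear_map (tensor_map D E)"
  unfolding tensor_map_def by (rule linear_map_linear_extension)

lemma linear_map_mult_map: "linear_map mult_map"
  unfolding mult_map_def by (rule linear_map_linear_extension)

interpretation mult_map: module_hom smul smul mult_map
  by (rule linear_map_mult_map)

lemma linear_map_mult_right: "linear_map (\<lambda>f. f * g)" for g :: "'v mpoly"
  by (intro linear_mapI) (simp_all add: algebra_simps)

lemma linear_map_id: "linear_map (\<lambda>x. x)"
  by (intro linear_mapI) auto

lemma linear_map_add:
  assumes "linear_map D" "linear_map E"
  shows "linear_map (\<lambda>x. D x + E x)"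
  using assms by (intro linear_mapI)
    (simp_all add: module_hom.add module_hom.scale smul.scale_right_distrib algebra_simps)

lemmas linear_map_intros =
  linear_map_id linear_map_add
  linear_map_mult linear_map_compose[OF _ linear_map_mult]
  linear_map_mult_right linear_map_compose[OF _ linear_map_mult_right]
  linear_map_pderivative linear_map_compose[OF _ linear_map_pderivative]
  linear_map_tensor_left linear_map_compose[OF _ linear_map_tensor_left]
  linear_map_tensor_right linear_map_compose[OF _ linear_map_tensor_right]
  linear_map_tensor_map linear_map_compose[OF _ linear_map_tensor_map]
  linear_map_mult_map linear_map_compose[OF _ linear_map_mult_map]

lemma tensor_map_tensor:
  assumes "linear_map D" "linear_map E"
  shows "tensor_map D E (f \<otimes> g) = D f \<otimes> E g"
proof (rule bilinear_eqI[where S = "\<lambda>f g. tensor_map D E (f \<otimes> g)" and T = "\<lambda>f g. D f \<otimes> E g"])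
  show "tensor_map D E (basis m \<otimes> basis m') = D (basis m) \<otimes> E (basis m')" for m m'
    by (simp add: tensor_map_def flip: basis_Pair)
qed (intro linear_map_intros linear_map_compose[OF assms(1) linear_map_tensor_left]
  linear_map_compose[OF assms(2) linear_map_tensor_right])+

lemma mult_map_tensor [simp]: "mult_map (f \<otimes> g) = f * g"
proof (rule bilinear_eqI[where S = "\<lambda>f g. mult_map (f \<otimes> g)" and T = "\<lambda>f g. f * g"])
  show "mult_map (basis m \<otimes> basis m') = basis m * basis m'" for m m' :: "'a \<Rightarrow>\<^sub>0 nat"
    by (simp add: mult_map_def flip: basis_Pair)
qed (intro linear_map_intros)+

section \<open>The star product\<close>

text \<open>
  The operator \<open>\<Omega>\<close> couples \<open>\<xi>\<^sub>i\<close> with \<open>z\<^sub>i\<close>. Writing it as a sum over all \<open>2n\<close> variables, each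
  paired with its partner, treats both kinds of variables at once.
\<close>
definition dual :: "'n + 'n \<Rightarrow> 'n + 'n" where
  "dual v = (case v of Inl i \<Rightarrow> Inr i | Inr i \<Rightarrow> Inl i)"

lemma dual_simps [simp]: "dual (Inl i) = Inr i" "dual (Inr i) = Inl i"
  by (simp_all add: dual_def)

lemma Omega_tensor:
  "\<Omega> (f \<otimes> g) = (\<Sum>v\<in>UNIV. pderivative v f \<otimes> pderivative (dual v) g)"
  by (simp add: \<Omega>_def tensor_map_tensor linear_map_pderivative sum.Plus sum.distrib
    add.commute flip: UNIV_Plus_UNIV)

lemma linear_map_Omega: "linear_map \<Omega>"
proof -
  have "linear_map (\<lambda>u. \<Omega> u)"
    unfolding \<Omega>_def by (intro linear_map_sum linear_map_add linear_map_tensor_map)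
  then show ?thesis by simp
qed

interpretation Omega: module_hom smul smul \<Omega>
  by (rule linear_map_Omega)

lemmas linear_map_Omega_intros =
  linear_map_intros linear_map_Omega linear_map_compose[OF _ linear_map_Omega]

text \<open>
  By the Leibniz rule only the summand of \<open>\<Omega>\<close> that differentiates the left factor by \<open>v\<close>
  fails to commute with multiplication by \<open>v\<close> on the left factor.
\<close>
lemma Omega_commutator:
  fixes v :: "'n::finite + 'n"
  shows "\<Omega> (tensor_map (\<lambda>f. Var v * f) (\<lambda>g. g) u)
    = tensor_map (\<lambda>f. Var v * f) (\<lambda>g. g) (\<Omega> u) + tensor_map (\<lambda>f. f) (pderivative (dual v)) u"
proof (rule tensor_eqI[where S = "\<lambda>u. \<Omega> (tensor_map (\<lambda>f. Var v * f) (\<lambda>g. g) u)" and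
      T = "\<lambda>u. tensor_map (\<lambda>f. Var v * f) (\<lambda>g. g) (\<Omega> u) + tensor_map (\<lambda>f. f) (pderivative (dual v)) u"])
  interpret X: module_hom smul smul "tensor_map (\<lambda>f. Var v * f) (\<lambda>g. g)"
    by (rule linear_map_tensor_map)
  fix f g :: "('n + 'n) mpoly"
  have "pderivative w (Var v * f) \<otimes> pderivative (dual w) g
      = (if w = v then f \<otimes> pderivative (dual v) g else 0)
        + (Var v * pderivative w f) \<otimes> pderivative (dual w) g" for w
    by (simp add: pderivative_Var_mult tensor_left.add)
  then show "\<Omega> (tensor_map (\<lambda>f. Var v * f) (\<lambda>g. g) (f \<otimes> g))
    = tensor_map (\<lambda>f. Var v * f) (\<lambda>g. g) (\<Omega> (f \<otimes> g))
      + tensor_map (\<lambda>f. f) (pderivative (dual v)) (f \<otimes> g)"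
    by (simp add: tensor_map_tensor linear_map_intros Omega_tensor X.sum sum.distrib sum.delta)
qed (intro linear_map_Omega_intros)+

lemma Omega_tensor_map_commute:
  fixes u :: "('n::finite + 'n) mpoly_tensor"
  assumes "linear_map D" "linear_map E"
    and "\<And>v f. pderivative v (D f) = D (pderivative v f)"
    and "\<And>v f. pderivative v (E f) = E (pderivative v f)"
  shows "\<Omega> (tensor_map D E u) = tensor_map D E (\<Omega> u)"
proof (rule tensor_eqI[where S = "\<lambda>u. \<Omega> (tensor_map D E u)" and T = "\<lambda>u. tensor_map D E (\<Omega> u)"])
  interpret X: module_hom smul smul "tensor_map D E"
    by (rule linear_map_tensor_map)
  fix f g :: "('n + 'n) mpoly"
  show "\<Omega> (tensor_map D E (f \<otimes> g)) = tensor_map D E (\<Omega> (f \<otimes> g))"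
    by (simp add: tensor_map_tensor assms Omega_tensor X.sum)
qed (intro linear_map_Omega_intros)+

lemma Omega_pderivative_right:
  "\<Omega> (tensor_map (\<lambda>f. f) (pderivative v) u) = tensor_map (\<lambda>f. f) (pderivative v) (\<Omega> u)"
  by (rule Omega_tensor_map_commute) (intro linear_map_intros refl pderivative_commute)+

lemmas exp_Omega_commutator = exp_op_commutator[where D = \<Omega>, OF linear_map_Omega linear_map_tensor_map
    linear_map_tensor_map Omega_commutator Omega_pderivative_right]

lemma nilpotent_Omega_tensor: "nilpotent_at \<Omega> (f \<otimes> g)"
proof (induction f rule: mpoly_induct)
  case one
  have "\<Omega> (1 \<otimes> g) = 0" by (simp add: Omega_tensor)
  then show ?case by (rule exp_op_kernel(1)[OF linear_map_Omega])
next
  case (add f1 f2)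
  then show ?case by (simp add: tensor_left.add exp_op_add linear_map_Omega)
next
  case (smul c f)
  then show ?case by (simp add: tensor_left.scale exp_op_smul linear_map_Omega)
next
  case (Var v f)
  have "nilpotent_at \<Omega> (tensor_map (\<lambda>f. Var v * f) (\<lambda>g. g) (f \<otimes> g))"
    by (rule exp_Omega_commutator(1)[OF Var])
  then show ?case by (simp add: tensor_map_tensor linear_map_intros)
qed

lemma star_one_left: "star t 1 g = g"
proof -
  have "\<Omega> (1 \<otimes> g) = 0" by (simp add: Omega_tensor)
  from exp_op_kernel(2)[OF linear_map_Omega this] show ?thesis by (simp add: star_def)
qed

lemma linear_map_star_left: "linear_map (\<lambda>f. star t f g)"
  and linear_map_star_right: "linear_map (\<lambda>g. star t f g)"
  by (auto intro!: linear_mapI simp: star_def tensor_left.add tensor_left.scale tensor_right.add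
      tensor_right.scale exp_op_add exp_op_smul linear_map_Omega nilpotent_Omega_tensor
      mult_map.add mult_map.scale)

interpretation star_left: module_hom smul smul "\<lambda>f. star t f g" for t g
  by (rule linear_map_star_left)

interpretation star_right: module_hom smul smul "\<lambda>g. star t f g" for t f
  by (rule linear_map_star_right)

lemma exp_Omega_tensor_map_commute:
  assumes "linear_map D" "linear_map E"
    and "\<And>v f. pderivative v (D f) = D (pderivative v f)"
    and "\<And>v f. pderivative v (E f) = E (pderivative v f)"
  shows "tensor_map D E (exp_op c \<Omega> (f \<otimes> g)) = exp_op c \<Omega> (D f \<otimes> E g)"
  using exp_op_commute[where D = \<Omega>, OF linear_map_Omega linear_map_tensor_map Omega_tensor_map_commute[OF assms]
      nilpotent_Omega_tensor[of f g], of c]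
  by (simp add: tensor_map_tensor assms)

text \<open>
  This recursion in the left factor is the commutator formula for \<open>exp (- t \<Omega>)\<close>, followed by
  multiplication. Together with \<open>star_one_left\<close> and linearity it determines the star product.
\<close>
lemma star_Var_mult: "star t (Var v * f) g = Var v * star t f g - smul t (star t f (pderivative (dual v) g))"
proof -
  let ?X = "tensor_map (\<lambda>f. Var v * f) (\<lambda>g. g)"
  let ?Y = "tensor_map (\<lambda>f. f) (pderivative (dual v))"
  let ?e = "exp_op (- t) \<Omega> (f \<otimes> g)"
  have "exp_op (- t) \<Omega> (?X (f \<otimes> g)) = ?X ?e + smul (- t) (?Y ?e)"
    by (rule exp_Omega_commutator(2)[OF nilpotent_Omega_tensor])
  also have "?Y ?e = exp_op (- t) \<Omega> (f \<otimes> pderivative (dual v) g)"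
    by (rule exp_Omega_tensor_map_commute) (intro linear_map_intros refl pderivative_commute)+
  finally have "exp_op (- t) \<Omega> ((Var v * f) \<otimes> g)
      = ?X ?e - smul t (exp_op (- t) \<Omega> (f \<otimes> pderivative (dual v) g))"
    by (simp add: tensor_map_tensor linear_map_intros)
  moreover have "mult_map (?X u) = Var v * mult_map u" for u
    by (rule tensor_eqI[where S = "\<lambda>u. mult_map (?X u)" and T = "\<lambda>u. Var v * mult_map u"])
      ((intro linear_map_intros)+, simp add: tensor_map_tensor linear_map_intros mult.assoc)
  ultimately show ?thesis
    by (simp add: star_def mult_map.diff mult_map.scale)
qed

text \<open>
  Partial derivatives remain derivations for the star product: the derivation
  \<open>\<partial> \<otimes> 1 + 1 \<otimes> \<partial>\<close> of the tensor square has constant coefficients and so commutes with \<open>\<Omega>\<close>.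
\<close>
lemma pderivative_star:
  "pderivative v (star t f g) = star t (pderivative v f) g + star t f (pderivative v g)"
proof -
  let ?D1 = "tensor_map (pderivative v) (\<lambda>g. g)"
  let ?D2 = "tensor_map (\<lambda>f. f) (pderivative v)"
  have "pderivative v (mult_map u) = mult_map (?D1 u + ?D2 u)" for u
    by (rule tensor_eqI[where S = "\<lambda>u. pderivative v (mult_map u)" and T = "\<lambda>u. mult_map (?D1 u + ?D2 u)"])
      ((intro linear_map_intros)+, simp add: tensor_map_tensor linear_map_intros pderivative_mult mult_map.add)
  then show ?thesis
    unfolding star_def
    by (simp add: mult_map.add exp_Omega_tensor_map_commute linear_map_intros pderivative_commute)
qed

section \<open>The isomorphism with the usual polynomial algebra\<close>

definition mixed_laplacian :: "('n::finite + 'n) mpoly \<Rightarrow> ('n + 'n) mpoly" where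
  "mixed_laplacian f = (\<Sum>i\<in>UNIV. \<delta> i (\<partial> i f))"

definition exp_laplacian :: "complex \<Rightarrow> ('n::finite + 'n) mpoly \<Rightarrow> ('n + 'n) mpoly" where
  "exp_laplacian c = exp_op c mixed_laplacian"

lemma linear_map_mixed_laplacian: "linear_map mixed_laplacian"
proof -
  have "linear_map (\<lambda>f. mixed_laplacian f)"
    unfolding mixed_laplacian_def by (intro linear_map_sum linear_map_intros)
  then show ?thesis by simp
qed

lemma mixed_laplacian_Var_mult:
  "mixed_laplacian (Var v * f) = Var v * mixed_laplacian f + pderivative (dual v) f"
proof (cases v)
  case (Inl j)
  have "\<delta> i (\<partial> i (\<xi> j * f)) = \<xi> j * \<delta> i (\<partial> i f) + (if i = j then \<partial> j f else 0)" for i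
    by (simp add: pderivative_Var_mult)
  then show ?thesis
    by (simp add: Inl mixed_laplacian_def sum.distrib sum_distrib_left)
next
  case (Inr j)
  have "\<delta> i (\<partial> i (Z j * f)) = Z j * \<delta> i (\<partial> i f) + (if i = j then \<delta> j f else 0)" for i
    by (simp add: pderivative_Var_mult pderivative.add)
  then show ?thesis
    by (simp add: Inr mixed_laplacian_def sum.distrib sum_distrib_left)
qed

lemma mixed_laplacian_pderivative:
  "mixed_laplacian (pderivative v f) = pderivative v (mixed_laplacian f)"
  by (simp add: mixed_laplacian_def pderivative.sum)
    (intro sum.cong refl, metis pderivative_commute)

lemmas exp_mixed_laplacian_commutator = exp_op_commutator[where D = mixed_laplacian,
    OF linear_map_mixed_laplacian linear_map_mult linear_map_pderivative
      mixed_laplacian_Var_mult mixed_laplacian_pderivative]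

lemma nilpotent_mixed_laplacian: "nilpotent_at mixed_laplacian f"
proof (induction f rule: mpoly_induct)
  case one
  show ?case
    by (rule exp_op_kernel(1)[OF linear_map_mixed_laplacian]) (simp add: mixed_laplacian_def)
next
  case (Var v f)
  show ?case
    by (rule exp_mixed_laplacian_commutator(1)[OF Var])
qed (simp_all add: exp_op_add exp_op_smul linear_map_mixed_laplacian)

lemma linear_map_exp_laplacian: "linear_map (exp_laplacian c)"
  by (intro linear_mapI)
    (simp_all add: exp_laplacian_def exp_op_add exp_op_smul linear_map_mixed_laplacian nilpotent_mixed_laplacian)

interpretation exp_laplacian: module_hom smul smul "exp_laplacian c" for c
  by (rule linear_map_exp_laplacian)

lemma exp_laplacian_kernel: "mixed_laplacian f = 0 \<Longrightarrow> exp_laplacian c f = f"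
  unfolding exp_laplacian_def by (rule exp_op_kernel(2)[OF linear_map_mixed_laplacian])

lemma exp_laplacian_one [simp]: "exp_laplacian c 1 = 1"
  by (rule exp_laplacian_kernel) (simp add: mixed_laplacian_def)

lemma exp_laplacian_pderivative: "exp_laplacian c (pderivative v f) = pderivative v (exp_laplacian c f)"
  unfolding exp_laplacian_def
  by (rule exp_op_commute[where X = "pderivative v", OF linear_map_mixed_laplacian linear_map_pderivative
        mixed_laplacian_pderivative nilpotent_mixed_laplacian])

text \<open>
  With \<open>exp_laplacian_one\<close> and linearity, this recursion determines the map. It is the
  commutator formula again, since differentiation by the partner of \<open>v\<close> is the commutator of
  the mixed Laplacian with multiplication by \<open>v\<close>.
\<close>
lemma exp_laplacian_Var_mult:
  "exp_laplacian c (Var v * f) = Var v * exp_laplacian c f + smul c (pderivative (dual v) (exp_laplacian c f))"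
  unfolding exp_laplacian_def
  by (rule exp_mixed_laplacian_commutator(2)[OF nilpotent_mixed_laplacian])

lemma exp_laplacian_inverse: "exp_laplacian c (exp_laplacian (- c) f) = f"
  by (induction f rule: mpoly_induct)
    (simp_all add: exp_laplacian.add exp_laplacian.diff exp_laplacian.scale exp_laplacian_Var_mult exp_laplacian_pderivative)

lemma exp_laplacian_inverse': "exp_laplacian (- c) (exp_laplacian c f) = f"
  using exp_laplacian_inverse[of "- c" f] by simp

text \<open>
  The correction \<open>- t \<partial>\<close> that \<open>exp_laplacian (- t)\<close> picks up when a variable is split off from
  \<open>f * g\<close> is distributed by the product rule over both star factors. The part on the left
  factor is the one that \<open>f\<close> picks up, the part on the right factor is the one in
  \<open>star_Var_mult\<close>. So both sides obey the same recursion in \<open>f\<close>.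
\<close>
lemma star_exp_laplacian:
  "star t (exp_laplacian (- t) f) (exp_laplacian (- t) g) = exp_laplacian (- t) (f * g)"
proof (induction f rule: mpoly_induct)
  case (Var v f)
  then show ?case
    by (simp add: exp_laplacian_Var_mult star_left.diff star_left.scale star_Var_mult
        mult.assoc pderivative_star smul.scale_right_distrib flip: Var)
qed (simp_all add: star_one_left exp_laplacian.add exp_laplacian.scale star_left.add star_left.scale algebra_simps)

lemma exp_laplacian_star: "exp_laplacian t (star t f g) = exp_laplacian t f * exp_laplacian t g"
  using star_exp_laplacian[of t "exp_laplacian t f" "exp_laplacian t g"]
  by (metis exp_laplacian_inverse exp_laplacian_inverse')

section \<open>The evaluation homomorphism\<close>

definition eval_xi_zero :: "('n + 'n) mpoly \<Rightarrow> ('n + 'n) mpoly" where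
  "eval_xi_zero = linear_extension (\<lambda>m. if \<forall>i. Poly_Mapping.lookup m (Inl i) = 0 then basis m else 0)"

interpretation eval_xi_zero: module_hom smul smul eval_xi_zero
  unfolding eval_xi_zero_def by (rule linear_map_linear_extension)

lemma lookup_eval_xi_zero:
  "Poly_Mapping.lookup (eval_xi_zero f) m
    = (if \<forall>i. Poly_Mapping.lookup m (Inl i) = 0 then Poly_Mapping.lookup f m else 0)"
proof (induction f rule: basis_induct)
  case (basis k)
  show ?case by (auto simp: eval_xi_zero_def lookup_basis)
qed (simp_all add: eval_xi_zero.add eval_xi_zero.scale lookup_add)

lemma polys_z_iff:
  "f \<in> polys_z \<longleftrightarrow> (\<forall>m i. Poly_Mapping.lookup m (Inl i) \<noteq> 0 \<longrightarrow> Poly_Mapping.lookup f m = 0)"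
  by (simp only: polys_z_def Ball_def in_keys_iff mem_Collect_eq not_imp imp_conv_disj not_not) blast

lemma eval_xi_zero_in_polys_z: "eval_xi_zero f \<in> polys_z"
  unfolding polys_z_iff lookup_eval_xi_zero by presburger

lemma eval_xi_zero_one [simp]: "eval_xi_zero 1 = 1"
  by (simp add: eval_xi_zero_def flip: basis_zero)

lemma eval_xi_zero_Var_mult:
  "eval_xi_zero (\<xi> i * f) = 0" "eval_xi_zero (Z i * f) = Z i * eval_xi_zero f"
proof -
  show "eval_xi_zero (\<xi> i * f) = 0"
    by (rule poly_mapping_eqI) (simp add: lookup_eval_xi_zero lookup_Var_mult)
  show "eval_xi_zero (Z i * f) = Z i * eval_xi_zero f"
    by (rule poly_mapping_eqI)
      (simp add: lookup_eval_xi_zero lookup_Var_mult lookup_minus lookup_single)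
qed

lemma eval_xi_zero_Var [simp]:
  "eval_xi_zero (\<xi> i) = 0" "eval_xi_zero (Z i) = Z i"
  using eval_xi_zero_Var_mult[of i 1] by (simp_all only: mult_1_right eval_xi_zero_one)

lemma eval_xi_zero_mult: "eval_xi_zero (f * g) = eval_xi_zero f * eval_xi_zero g"
proof (induction f rule: mpoly_induct)
  case (Var v f)
  then show ?case by (cases v) (simp_all add: mult.assoc eval_xi_zero_Var_mult)
qed (simp_all add: eval_xi_zero.add eval_xi_zero.scale algebra_simps)

lemma exp_laplacian_Var [simp]: "exp_laplacian c (Var v) = Var v"
  using exp_laplacian_Var_mult[of c v 1] by simp

lemma is_evaluation_exp_laplacian: "is_evaluation t (\<lambda>f. eval_xi_zero (exp_laplacian t f))"
  by (auto simp: is_evaluation_def eval_xi_zero_in_polys_z exp_laplacian.add exp_laplacian.scale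
      eval_xi_zero.add eval_xi_zero.scale exp_laplacian_star eval_xi_zero_mult)

text \<open>
  Transported along \<open>exp_laplacian\<close>, an evaluation becomes a homomorphism of the usual
  polynomial algebra with prescribed values on the variables.
\<close>
lemma is_evaluation_unique:
  assumes "is_evaluation t \<phi>"
  shows "\<phi> f = eval_xi_zero (exp_laplacian t f)"
proof -
  note phi = assms[unfolded is_evaluation_def]
  have "\<phi> (exp_laplacian (- t) g) = eval_xi_zero g" for g
  proof (induction g rule: mpoly_induct)
    case (Var v g)
    have "exp_laplacian (- t) (Var v * g) = star t (Var v) (exp_laplacian (- t) g)"
      by (simp flip: star_exp_laplacian)
    then have "\<phi> (exp_laplacian (- t) (Var v * g)) = \<phi> (Var v) * eval_xi_zero g"
      using phi Var by simp
    then show ?case using phi by (cases v) (simp_all add: eval_xi_zero_Var_mult)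
  qed (use phi in \<open>simp_all add: exp_laplacian.add exp_laplacian.scale eval_xi_zero.add eval_xi_zero.scale\<close>)
  from this[of "exp_laplacian t f"] show ?thesis by (simp add: exp_laplacian_inverse')
qed

lemma evaluation_eq:
  fixes f :: "('n::finite + 'n) mpoly"
  shows "\<E> t f = eval_xi_zero (exp_laplacian t f)"
proof -
  have "\<E> t = (\<lambda>f :: ('n + 'n) mpoly. eval_xi_zero (exp_laplacian t f))"
    unfolding \<E>_def using is_evaluation_exp_laplacian is_evaluation_unique by (intro the_equality) blast+
  then show ?thesis by simp
qed

section \<open>Powers of commuting operators\<close>

lemma funpow_commuting:
  assumes "\<And>x. f (g x) = g (f x)"
  shows "(f ^^ m) ((g ^^ n) x) = (g ^^ n) ((f ^^ m) x)"
proof -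
  have "f ((g ^^ n) x) = (g ^^ n) (f x)" for x
    by (induction n) (simp_all add: assms)
  then show ?thesis by (induction m) simp_all
qed

text \<open>
  A fold over a set is governed by its recursion equation only if the folded operators
  commute; this is where commutativity of the \<open>D i\<close> enters.
\<close>
lemma fold_commuting_insert:
  assumes "\<And>i j x. D i (D j x) = D j (D i x)" "finite A" "i \<notin> A"
  shows "Finite_Set.fold (\<lambda>i. D i ^^ \<alpha> i) x (insert i A)
    = (D i ^^ \<alpha> i) (Finite_Set.fold (\<lambda>i. D i ^^ \<alpha> i) x A)"
proof -
  interpret comp_fun_commute_on UNIV "\<lambda>i. D i ^^ \<alpha> i"
    by unfold_locales (auto simp: fun_eq_iff intro: funpow_commuting assms(1))
  show ?thesis using assms by (intro fold_insert) auto
qed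

lemma op_power_intertwine:
  assumes D: "\<And>i j x. D i (D j x) = D j (D i x)" and D': "\<And>i j x. D' i (D' j x) = D' j (D' i x)"
    and T: "\<And>i x. T (D i x) = D' i (T x)"
  shows "T (op_power D \<alpha> x) = op_power D' \<alpha> (T x)"
proof -
  have pow: "T ((D i ^^ k) x) = (D' i ^^ k) (T x)" for i k x
    by (induction k) (simp_all add: T)
  have "T (Finite_Set.fold (\<lambda>i. D i ^^ \<alpha> i) x A) = Finite_Set.fold (\<lambda>i. D' i ^^ \<alpha> i) (T x) A"
    if "finite A" for A
    using that
    by induction (simp_all add: pow fold_commuting_insert[of D, OF D] fold_commuting_insert[of D', OF D'])
  then show ?thesis by (simp add: op_power_def)
qed

lemma op_power_mult_xi: "op_power (\<lambda>i g. \<xi> i * g) \<alpha> f = \<xi>_power \<alpha> * f"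
proof -
  have pow: "((\<lambda>g. \<xi> i * g) ^^ k) g = \<xi> i ^ k * g" for i :: 'a and k g
    by (induction k) (simp_all add: mult.assoc)
  have "Finite_Set.fold (\<lambda>i. (\<lambda>g. \<xi> i * g) ^^ \<alpha> i) f A = (\<Prod>i\<in>A. \<xi> i ^ \<alpha> i) * f"
    if "finite A" for A
    using that
  proof induction
    case (insert i A)
    have "Finite_Set.fold (\<lambda>i. (\<lambda>g. \<xi> i * g) ^^ \<alpha> i) f (insert i A)
        = ((\<lambda>g. \<xi> i * g) ^^ \<alpha> i) ((\<Prod>i\<in>A. \<xi> i ^ \<alpha> i) * f)"
      unfolding insert.IH[symmetric]
      by (rule fold_commuting_insert[where D = "\<lambda>i g. \<xi> i * g", OF mult.left_commute insert.hyps])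
    also have "\<dots> = \<xi> i ^ \<alpha> i * ((\<Prod>i\<in>A. \<xi> i ^ \<alpha> i) * f)"
      by (rule pow)
    finally show ?case
      unfolding prod.insert[OF insert.hyps] mult.assoc .
  qed simp
  then show ?thesis by (simp add: op_power_def \<xi>_power_def)
qed

section \<open>The Taylor expansion\<close>

definition xi_monomial :: "('n::finite \<Rightarrow> nat) \<Rightarrow> ('n + 'n) \<Rightarrow>\<^sub>0 nat" where
  "xi_monomial \<alpha> = (\<Sum>i\<in>UNIV. Poly_Mapping.single (Inl i) (\<alpha> i))"

definition xi_exponent :: "(('n + 'n) \<Rightarrow>\<^sub>0 nat) \<Rightarrow> 'n \<Rightarrow> nat" where
  "xi_exponent m i = Poly_Mapping.lookup m (Inl i)"

lemma lookup_xi_monomial [simp]: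
  "Poly_Mapping.lookup (xi_monomial \<alpha>) (Inl i) = \<alpha> i"
  "Poly_Mapping.lookup (xi_monomial \<alpha>) (Inr i) = 0"
  by (simp_all add: xi_monomial_def lookup_sum lookup_single when_def sum.delta)

lemma xi_power_eq_basis: "\<xi>_power \<alpha> = basis (xi_monomial \<alpha>)"
proof -
  have "(\<Prod>i\<in>A. \<xi> i ^ \<alpha> i) = basis (\<Sum>i\<in>A. Poly_Mapping.single (Inl i) (\<alpha> i))" if "finite A" for A
    using that by induction (simp_all add: basis_zero basis_single flip: basis_mult)
  then show ?thesis by (simp add: \<xi>_power_def xi_monomial_def)
qed

text \<open>
  As \<open>b\<close> is free of \<open>\<xi>\<close>, the exponents of \<open>\<xi>\<close> in a monomial of \<open>\<xi>\<^sup>\<alpha> b\<close> are exactly \<open>\<alpha>\<close>. Hence the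
  products \<open>\<xi>\<^sup>\<alpha> b\<^sub>\<alpha>\<close> for different \<open>\<alpha>\<close> have no monomial in common.
\<close>
lemma lookup_xi_power_mult:
  assumes "b \<in> polys_z"
  shows "Poly_Mapping.lookup (\<xi>_power \<alpha> * b) m
    = (if \<alpha> = xi_exponent m then Poly_Mapping.lookup b (m - xi_monomial \<alpha>) else 0)"
proof (cases "\<alpha> = xi_exponent m")
  case True
  have "m = xi_monomial \<alpha> + (m - xi_monomial \<alpha>)"
  proof (rule poly_mapping_eqI)
    fix v show "Poly_Mapping.lookup m v = Poly_Mapping.lookup (xi_monomial \<alpha> + (m - xi_monomial \<alpha>)) v"
      by (cases v) (simp_all add: lookup_add lookup_minus True xi_exponent_def)
  qed
  then show ?thesis by (auto simp: xi_power_eq_basis lookup_basis_mult True)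
next
  case False
  have "Poly_Mapping.lookup b k = 0" if "m = xi_monomial \<alpha> + k" for k
  proof -
    have "xi_exponent m i = \<alpha> i + Poly_Mapping.lookup k (Inl i)" for i
      by (simp add: that xi_exponent_def lookup_add)
    then have "\<exists>i. Poly_Mapping.lookup k (Inl i) \<noteq> 0" using False by auto
    then show ?thesis using assms by (auto simp: polys_z_iff)
  qed
  then show ?thesis using False by (auto simp: xi_power_eq_basis lookup_basis_mult)
qed

text \<open>
  For an exponent that does not contain \<open>v\<close>, the weights \<open>1, \<dots>, k\<close> of the \<open>k\<close> successive
  shifts multiply to \<open>k!\<close>.
\<close>
lemma lookup_pderivative_funpow:
  assumes "Poly_Mapping.lookup m v = 0"
  shows "Poly_Mapping.lookup ((pderivative v ^^ k) f) m
    = fact k * Poly_Mapping.lookup f (m + Poly_Mapping.single v k)"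
proof (induction k arbitrary: f)
  case (Suc k)
  have "m + Poly_Mapping.single v k + Poly_Mapping.single v 1 = m + Poly_Mapping.single v (Suc k)"
    by (simp add: add.assoc flip: single_add)
  then show ?case
    using assms by (simp add: funpow_Suc_right Suc lookup_pderivative lookup_add del: funpow.simps)
qed simp

lemma lookup_op_power_delta:
  assumes "\<forall>i. Poly_Mapping.lookup m (Inl i) = 0"
  shows "Poly_Mapping.lookup (op_power \<delta> \<alpha> f) m = mfact \<alpha> * Poly_Mapping.lookup f (m + xi_monomial \<alpha>)"
proof -
  have "Poly_Mapping.lookup (Finite_Set.fold (\<lambda>i. \<delta> i ^^ \<alpha> i) f A) m =
      (\<Prod>i\<in>A. fact (\<alpha> i)) * Poly_Mapping.lookup f (m + (\<Sum>i\<in>A. Poly_Mapping.single (Inl i) (\<alpha> i)))"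
    if "finite A" "\<forall>i\<in>A. Poly_Mapping.lookup m (Inl i) = 0" for A m
    using that
  proof (induction arbitrary: m)
    case (insert i A)
    then have "\<forall>j\<in>A. Poly_Mapping.lookup (m + Poly_Mapping.single (Inl i) (\<alpha> i)) (Inl j) = 0"
      by (auto simp: lookup_add lookup_single when_def)
    then show ?case
      using insert fold_commuting_insert[of \<delta>, OF pderivative_commute insert.hyps, of \<alpha> f]
      by (simp add: lookup_pderivative_funpow add.assoc)
  qed simp
  from this[of UNIV m] show ?thesis
    using assms by (simp add: op_power_def mfact_def xi_monomial_def)
qed

definition taylor_sum :: "(('n::finite \<Rightarrow> nat) \<Rightarrow> ('n + 'n) mpoly) \<Rightarrow> ('n + 'n) mpoly" where
  "taylor_sum b = Sum_any (\<lambda>\<alpha>. smul (1 / mfact \<alpha>) (\<xi>_power \<alpha> * b \<alpha>))"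

lemma mfact_nonzero [simp]: "mfact \<alpha> \<noteq> 0"
  by (simp add: mfact_def)

lemma lookup_taylor_sum:
  assumes "coefficient_family b"
  shows "Poly_Mapping.lookup (taylor_sum b) m = Poly_Mapping.lookup (b (xi_exponent m))
    (m - xi_monomial (xi_exponent m)) / mfact (xi_exponent m)"
proof -
  have b: "b \<alpha> \<in> polys_z" for \<alpha> using assms by (simp add: coefficient_family_def)
  let ?S = "insert (xi_exponent m) {\<alpha>. b \<alpha> \<noteq> 0}"
  have "finite ?S" using assms by (simp add: coefficient_family_def)
  moreover have "taylor_sum b = (\<Sum>\<alpha>\<in>?S. smul (1 / mfact \<alpha>) (\<xi>_power \<alpha> * b \<alpha>))"
    unfolding taylor_sum_def using \<open>finite ?S\<close> by (intro Sum_any.expand_superset) auto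
  then have "Poly_Mapping.lookup (taylor_sum b) m = (\<Sum>\<alpha>\<in>?S. if \<alpha> = xi_exponent m then
      Poly_Mapping.lookup (b \<alpha>) (m - xi_monomial \<alpha>) / mfact \<alpha> else 0)"
    by (simp only: lookup_sum) (auto intro!: sum.cong simp: lookup_xi_power_mult[OF b])
  ultimately show ?thesis by (simp add: sum.delta)
qed

lemma coefficient_family_taylor: "coefficient_family (\<lambda>\<alpha>. eval_xi_zero (op_power \<delta> \<alpha> h))"
proof -
  have "\<alpha> \<in> xi_exponent ` Poly_Mapping.keys h" if "eval_xi_zero (op_power \<delta> \<alpha> h) \<noteq> 0" for \<alpha>
  proof -
    from that obtain m where m: "Poly_Mapping.lookup (eval_xi_zero (op_power \<delta> \<alpha> h)) m \<noteq> 0"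
      by (metis lookup_zero poly_mapping_eqI)
    then have pure: "\<forall>i. Poly_Mapping.lookup m (Inl i) = 0"
      by (auto simp: lookup_eval_xi_zero split: if_splits)
    then have "m + xi_monomial \<alpha> \<in> Poly_Mapping.keys h"
      using m by (simp add: lookup_eval_xi_zero lookup_op_power_delta in_keys_iff)
    moreover have "xi_exponent (m + xi_monomial \<alpha>) = \<alpha>"
      using pure by (auto simp: xi_exponent_def lookup_add)
    ultimately show ?thesis by force
  qed
  then have "{\<alpha>. eval_xi_zero (op_power \<delta> \<alpha> h) \<noteq> 0} \<subseteq> xi_exponent ` Poly_Mapping.keys h"
    by blast
  then have "finite {\<alpha>. eval_xi_zero (op_power \<delta> \<alpha> h) \<noteq> 0}"
    by (rule finite_subset) simp
  then show ?thesis by (simp add: coefficient_family_def eval_xi_zero_in_polys_z)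
qed

text \<open>
  The usual Taylor formula in \<open>\<xi>\<close> at \<open>\<xi> = 0\<close>. Both directions read off the coefficient of a
  monomial \<open>\<xi>\<^sup>\<alpha> z\<^sup>\<beta>\<close>: by \<open>lookup_taylor_sum\<close> only the summand \<open>\<alpha>\<close> contributes to it, and \<open>\<delta>\<^sup>\<alpha>\<close>
  followed by \<open>\<xi> = 0\<close> extracts it with the factor \<open>\<alpha>!\<close>.
\<close>
lemma taylor_expansion_iff:
  assumes b: "coefficient_family b"
  shows "h = taylor_sum b \<longleftrightarrow> b = (\<lambda>\<alpha>. eval_xi_zero (op_power \<delta> \<alpha> h))"
proof
  assume h: "h = taylor_sum b"
  show "b = (\<lambda>\<alpha>. eval_xi_zero (op_power \<delta> \<alpha> h))"
  proof (intro ext poly_mapping_eqI)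
    fix \<alpha> :: "'a \<Rightarrow> nat" and m :: "('a + 'a) \<Rightarrow>\<^sub>0 nat"
    show "Poly_Mapping.lookup (b \<alpha>) m = Poly_Mapping.lookup (eval_xi_zero (op_power \<delta> \<alpha> h)) m"
    proof (cases "\<forall>i. Poly_Mapping.lookup m (Inl i) = 0")
      case True
      then have "xi_exponent (m + xi_monomial \<alpha>) = \<alpha>"
        by (auto simp: xi_exponent_def lookup_add)
      then show ?thesis
        using True by (simp add: lookup_eval_xi_zero lookup_op_power_delta h lookup_taylor_sum[OF b])
    next
      case False
      then show ?thesis
        using b by (auto simp: lookup_eval_xi_zero coefficient_family_def polys_z_iff)
    qed
  qed
next
  assume b_eq: "b = (\<lambda>\<alpha>. eval_xi_zero (op_power \<delta> \<alpha> h))"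
  show "h = taylor_sum b"
  proof (rule poly_mapping_eqI)
    fix m :: "('a + 'a) \<Rightarrow>\<^sub>0 nat"
    let ?k = "m - xi_monomial (xi_exponent m)"
    have pure: "\<forall>i. Poly_Mapping.lookup ?k (Inl i) = 0"
      by (simp add: lookup_minus xi_exponent_def)
    have "?k + xi_monomial (xi_exponent m) = m"
    proof (rule poly_mapping_eqI)
      fix v show "Poly_Mapping.lookup (?k + xi_monomial (xi_exponent m)) v = Poly_Mapping.lookup m v"
        by (cases v) (simp_all add: lookup_add lookup_minus xi_exponent_def)
    qed
    then show "Poly_Mapping.lookup h m = Poly_Mapping.lookup (taylor_sum b) m"
      using pure by (simp add: lookup_taylor_sum[OF b]) (simp add: b_eq lookup_eval_xi_zero lookup_op_power_delta)
  qed
qed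

section \<open>The two expansions\<close>

text \<open>
  Every summand of the mixed Laplacian differentiates by some \<open>\<xi>\<^sub>i\<close> and by the corresponding
  \<open>z\<^sub>i\<close>, so that it kills the polynomials in only one of the two kinds of variables.
\<close>
lemma exp_laplacian_polys_z:
  assumes "b \<in> polys_z"
  shows "exp_laplacian c b = b"
proof (rule exp_laplacian_kernel)
  have "\<delta> i b = 0" for i
  proof (rule poly_mapping_eqI)
    fix m :: "('a + 'a) \<Rightarrow>\<^sub>0 nat"
    have "Poly_Mapping.lookup b (m + Poly_Mapping.single (Inl i) 1) = 0"
      using assms[unfolded polys_z_iff, rule_format, of "m + Poly_Mapping.single (Inl i) 1" i]
      by (simp add: lookup_add)
    then show "Poly_Mapping.lookup (\<delta> i b) m = Poly_Mapping.lookup 0 m"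
      by (simp add: lookup_pderivative)
  qed
  then show "mixed_laplacian b = 0"
    by (simp add: mixed_laplacian_def pderivative_commute[of "Inl _"])
qed

lemma exp_laplacian_xi_power: "exp_laplacian c (\<xi>_power \<alpha>) = \<xi>_power \<alpha>"
proof (rule exp_laplacian_kernel)
  have "\<partial> i (\<xi>_power \<alpha>) = 0" for i
    by (simp add: xi_power_eq_basis pderivative_def)
  then show "mixed_laplacian (\<xi>_power \<alpha>) = 0"
    by (simp add: mixed_laplacian_def)
qed

lemma exp_laplacian_inject: "exp_laplacian c f = exp_laplacian c g \<longleftrightarrow> f = g"
  by (metis exp_laplacian_inverse')

text \<open>
  The operator \<open>\<xi>\<^sub>i - t \<partial>\<^sub>i\<close> is conjugate to multiplication by \<open>\<xi>\<^sub>i\<close>. It equals star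
  multiplication by \<open>\<xi>\<^sub>i\<close>, which is why both expansions have the same coefficients.
\<close>
lemma exp_laplacian_shift_op: "exp_laplacian t (shift_op t i g) = \<xi> i * exp_laplacian t g"
  by (simp add: shift_op_def exp_laplacian.diff exp_laplacian.scale exp_laplacian_Var_mult exp_laplacian_pderivative)

lemma exp_laplacian_op_power_shift_op:
  fixes g :: "('n::finite + 'n) mpoly"
  shows "exp_laplacian t (op_power (shift_op t) \<alpha> g) = \<xi>_power \<alpha> * exp_laplacian t g"
proof -
  have "shift_op t i (shift_op t j g) = shift_op t j (shift_op t i g)"
    for i j and g :: "('n + 'n) mpoly"
    by (simp add: exp_laplacian_shift_op mult.left_commute flip: exp_laplacian_inject[of t])
  then have "exp_laplacian t (op_power (shift_op t) \<alpha> g) = op_power (\<lambda>i g. \<xi> i * g) \<alpha> (exp_laplacian t g)"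
    by (rule op_power_intertwine) (auto simp: exp_laplacian_shift_op mult.left_commute)
  then show ?thesis by (simp add: op_power_mult_xi)
qed

lemma evaluation_op_power_delta:
  "\<E> t (op_power \<delta> \<alpha> f) = eval_xi_zero (op_power \<delta> \<alpha> (exp_laplacian t f))"
proof -
  have "exp_laplacian t (op_power \<delta> \<alpha> f) = op_power \<delta> \<alpha> (exp_laplacian t f)"
    by (rule op_power_intertwine) (rule pderivative_commute exp_laplacian_pderivative)+
  then show ?thesis by (simp add: evaluation_eq)
qed

text \<open>
  Existence and uniqueness in one statement, for any vectors \<open>e \<alpha>\<close> that \<open>exp_laplacian t\<close> maps to
  \<open>\<xi>\<^sup>\<alpha> b\<^sub>\<alpha>\<close>: an expansion of \<open>f\<close> into them is the Taylor expansion of \<open>exp_laplacian t f\<close>,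
  pulled back.
\<close>
lemma expansion_iff:
  assumes b: "coefficient_family b"
    and e: "\<And>\<alpha>. exp_laplacian t (e \<alpha>) = \<xi>_power \<alpha> * b \<alpha>"
  shows "f = Sum_any (\<lambda>\<alpha>. smul (1 / mfact \<alpha>) (e \<alpha>)) \<longleftrightarrow> b = (\<lambda>\<alpha>. \<E> t (op_power \<delta> \<alpha> f))"
proof -
  have "e \<alpha> = 0" if "b \<alpha> = 0" for \<alpha>
    using e[of \<alpha>] that exp_laplacian_inject[of t "e \<alpha>" 0] by simp
  then have "finite {\<alpha>. smul (1 / mfact \<alpha>) (e \<alpha>) \<noteq> 0}"
    using b by (auto simp: coefficient_family_def elim!: rev_finite_subset)
  then have "exp_laplacian t (Sum_any (\<lambda>\<alpha>. smul (1 / mfact \<alpha>) (e \<alpha>))) = taylor_sum b"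
    by (simp add: linear_map_Sum_any[OF linear_map_exp_laplacian] exp_laplacian.scale e taylor_sum_def)
  then have "f = Sum_any (\<lambda>\<alpha>. smul (1 / mfact \<alpha>) (e \<alpha>)) \<longleftrightarrow> exp_laplacian t f = taylor_sum b"
    by (simp only: exp_laplacian_inject[of t f, symmetric])
  then show ?thesis
    by (simp add: taylor_expansion_iff[OF b] evaluation_op_power_delta)
qed

theorem theorem4p1:
  fixes t :: complex
    and f :: "('n::finite + 'n) mpoly"
    and a :: "('n \<Rightarrow> nat) \<Rightarrow> ('n + 'n) mpoly"
  assumes a_def: "\<And>\<alpha>. a \<alpha> = \<E> t (op_power \<delta> \<alpha> f)"
  shows "coefficient_family a \<and>
    f = expansion_I t a \<and>
    f = expansion_II t a \<and>
    (\<forall>b. coefficient_family b \<and> f = expansion_I t b \<longrightarrow> b = a) \<and>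
    (\<forall>b. coefficient_family b \<and> f = expansion_II t b \<longrightarrow> b = a)"
proof -
  have a: "a = (\<lambda>\<alpha>. \<E> t (op_power \<delta> \<alpha> f))" using a_def by auto
  have "coefficient_family a"
    using coefficient_family_taylor[of "exp_laplacian t f"] by (simp add: a evaluation_op_power_delta)
  moreover have "f = expansion_I t b \<longleftrightarrow> b = a" "f = expansion_II t b \<longleftrightarrow> b = a"
    if b: "coefficient_family b" for b
  proof -
    have z: "exp_laplacian t (b \<alpha>) = b \<alpha>" for \<alpha>
      using b by (intro exp_laplacian_polys_z) (simp add: coefficient_family_def)
    show "f = expansion_I t b \<longleftrightarrow> b = a"
      unfolding expansion_I_def a
      by (rule expansion_iff[OF b]) (simp add: exp_laplacian_star exp_laplacian_xi_power z)
    show "f = expansion_II t b \<longleftrightarrow> b = a"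
      unfolding expansion_II_def a
      by (rule expansion_iff[OF b]) (simp add: exp_laplacian_op_power_shift_op z)
  qed
  ultimately show ?thesis by blast
qed

end
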